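(* For every $n\in\mathbb{N}_0$ and all orders $v,\beta$, $$\sum_{r=0}^n\binom{n}{r}B_{n-r}^{(v)}(x;\lambda)\,{}_{T}B_{r}^{(s,\beta)}(x,y,2z;\lambda)=2\sum_{r=0}^n\binom{n}{r}B_{n-r}^{(s,v)}(x,z;\lambda)\,{}_{T}B_{r}^{(c,\beta)}(x,y,z;\lambda).$$
   Context: $\mathbb{N}_0=\{0,1,2,\dots\}$; $x,y,z$ are variables (taking complex values) and $\lambda\in\mathbb{C}\setminus\{0\}$. Let $\mathcal{U}(y,t)=\sum_{n\ge0}\mathcal{U}_n(y)\frac{t^n}{n!}$ be a power series in $t$ with coefficients depending on $y$ and $\mathcal{U}_0(y)\neq0$; the 2-variable general polynomials $T_n(x,y)$ are defined by $e^{xt}\mathcal{U}(y,t)=\sum_{n\ge0}T_n(x,y)\frac{t^n}{n!}$, with the normalization $T_0(x,y)=1$. An order $v$ (or $\beta$) is a number such that $\bigl(\frac{t}{\lambda e^t-1}\bigr)^v$ is a power series in $t$ ($v\in\mathbb{N}_0$ in general; $v\in\mathbb{C}$ allowed when $\lambda=1$, with the branch $1^v=1$ at $t=0$). The parametric kinds of generalized Apostol--Bernoulli polynomials are defined, as power series in $t$, by $$\Bigl(\frac{t}{\lambda e^t-1}\Bigr)^v e^{xt}\,\mathcal{U}(y,t)\cos(zt)=\sum_{n=0}^\infty {}_{T}B_{n}^{(c,v)}(x,y,z;\lambda)\frac{t^n}{n!},$$ $$\Bigl(\frac{t}{\lambda e^t-1}\Bigr)^v e^{xt}\,\mathcal{U}(y,t)\sin(zt)=\sum_{n=0}^\infty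 {}_{T}B_{n}^{(s,v)}(x,y,z;\lambda)\frac{t^n}{n!}.$$ The generalized Apostol--Bernoulli polynomials $B_n^{(v)}(x;\lambda)$ of order $v$ and the two-variable sine parametric polynomials $B_n^{(s,v)}(x,y;\lambda)$ are defined by $$\Bigl(\frac{t}{\lambda e^t-1}\Bigr)^v e^{xt}=\sum_{n=0}^\infty B_n^{(v)}(x;\lambda)\frac{t^n}{n!},\qquad \Bigl(\frac{t}{\lambda e^t-1}\Bigr)^v e^{xt}\sin(yt)=\sum_{n=0}^\infty B_n^{(s,v)}(x,y;\lambda)\frac{t^n}{n!}.$$ *)

theory Defs
  imports Complex_Main "HOL-Computational_Algebra.Formal_Power_Series"
begin

text \<open>All generating functions are formal power series in \<open>t\<close> (that is, \<^const>\<open>fps_X\<close>) over the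
  complex numbers. A series \<open>\<Sum>n. a\<^sub>n t^n / n!\<close> has the coefficients \<open>a\<^sub>n = n! * [t^n] F\<close>.\<close>

definition egf :: "(nat \<Rightarrow> complex) \<Rightarrow> complex fps" where
  "egf a = Abs_fps (\<lambda>n. a n / fact n)"

definition egf_coeff :: "complex fps \<Rightarrow> nat \<Rightarrow> complex" where
  "egf_coeff F n = fact n * fps_nth F n"

lemma egf_egf_coeff [simp]: "egf (egf_coeff F) = F"
  by (simp add: egf_def egf_coeff_def fps_eq_iff)

lemma egf_coeff_egf [simp]: "egf_coeff (egf a) = a"
  by (simp add: egf_def egf_coeff_def fun_eq_iff)

text \<open>The series \<open>t / (\<lambda> e^t - 1)\<close>. For \<open>\<lambda> = 1\<close> the common factor \<open>t\<close> is cancelled by the division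
  of power series.\<close>

definition apostol_series :: "complex \<Rightarrow> complex fps" where
  "apostol_series l = fps_X / (fps_const l * fps_exp 1 - 1)"

lemma apostol_series_times:
  assumes "l \<noteq> 0"
  shows "apostol_series l * (fps_const l * fps_exp 1 - 1) = fps_X"
proof -
  let ?D = "fps_const l * fps_exp 1 - 1 :: complex fps"
  have 1: "fps_nth ?D 1 \<noteq> 0"
    using assms by simp
  then have "?D \<noteq> 0" "subdegree ?D \<le> 1"
    by (metis fps_zero_nth, metis subdegree_leI)
  then have "?D dvd fps_X"
    by (simp add: fps_dvd_iff)
  then show ?thesis
    by (simp add: apostol_series_def)
qed

lemma apostol_series_one_nth_0: "fps_nth (apostol_series 1) 0 = 1"
proof -
  have "fps_nth (apostol_series 1 * (fps_const 1 * fps_exp 1 - 1)) 1 = 1"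
    by (subst apostol_series_times) simp_all
  then show ?thesis
    by (simp add: fps_mult_nth)
qed

text \<open>Orders: natural numbers, and arbitrary complex numbers if \<open>\<lambda> = 1\<close>.\<close>

definition apostol_order :: "complex \<Rightarrow> complex \<Rightarrow> bool" where
  "apostol_order l v \<longleftrightarrow> v \<in> \<nat> \<or> l = 1"

text \<open>The power \<open>(t / (\<lambda> e^t - 1))^v\<close>. For \<open>\<lambda> = 1\<close> the base has constant term 1 and the power is
  the binomial series \<open>(1 + u)^v\<close> at \<open>u = t / (e^t - 1) - 1\<close>, which is the branch with \<open>1^v = 1\<close>
  at \<open>t = 0\<close>. The value is irrelevant if \<open>v\<close> is not an order.\<close>

definition apostol_power :: "complex \<Rightarrow> complex \<Rightarrow> complex fps" where
  "apostol_power l v =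
     (if l = 1 then fps_binomial v oo (apostol_series 1 - 1)
      else apostol_series l ^ (THE k. v = of_nat k))"

lemma apostol_power_of_nat: "apostol_power l (of_nat k) = apostol_series l ^ k"
proof (cases "l = 1")
  case True
  have 0: "fps_nth (apostol_series 1 - 1) 0 = 0"
    by (simp add: apostol_series_one_nth_0)
  have "fps_binomial (of_nat k) oo (apostol_series 1 - 1)
          = ((1 + fps_X) oo (apostol_series 1 - 1)) ^ k"
    by (simp only: fps_binomial_of_nat fps_compose_power[OF 0])
  also have "(1 + fps_X) oo (apostol_series 1 - 1) = apostol_series 1"
    using 0 by (simp add: fps_compose_add_distrib)
  finally show ?thesis
    using True by (simp add: apostol_power_def)
qed (simp add: apostol_power_def)

text \<open>In the following \<open>U n y\<close> is the coefficient \<open>U\<^sub>n(y)\<close> of the series \<open>U(y,t)\<close>.\<close>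

definition general_poly ::
    "(nat \<Rightarrow> complex \<Rightarrow> complex) \<Rightarrow> nat \<Rightarrow> complex \<Rightarrow> complex \<Rightarrow> complex" where
  "general_poly U n x y = egf_coeff (fps_exp x * egf (\<lambda>k. U k y)) n"

definition admissible :: "(nat \<Rightarrow> complex \<Rightarrow> complex) \<Rightarrow> bool" where
  "admissible U \<longleftrightarrow> (\<forall>y. U 0 y \<noteq> 0) \<and> (\<forall>x y. general_poly U 0 x y = 1)"

definition apostol_bernoulli :: "nat \<Rightarrow> complex \<Rightarrow> complex \<Rightarrow> complex \<Rightarrow> complex" where
  "apostol_bernoulli n v x l = egf_coeff (apostol_power l v * fps_exp x) n"

definition apostol_bernoulli_sin ::
    "nat \<Rightarrow> complex \<Rightarrow> complex \<Rightarrow> complex \<Rightarrow> complex \<Rightarrow> complex" where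
  "apostol_bernoulli_sin n v x y l =
     egf_coeff (apostol_power l v * fps_exp x * fps_sin y) n"

definition general_apostol_bernoulli_cos ::
    "(nat \<Rightarrow> complex \<Rightarrow> complex) \<Rightarrow> nat \<Rightarrow> complex \<Rightarrow>
       complex \<Rightarrow> complex \<Rightarrow> complex \<Rightarrow> complex \<Rightarrow> complex" where
  "general_apostol_bernoulli_cos U n v x y z l =
     egf_coeff (apostol_power l v * fps_exp x * egf (\<lambda>k. U k y) * fps_cos z) n"

definition general_apostol_bernoulli_sin ::
    "(nat \<Rightarrow> complex \<Rightarrow> complex) \<Rightarrow> nat \<Rightarrow> complex \<Rightarrow>
       complex \<Rightarrow> complex \<Rightarrow> complex \<Rightarrow> complex \<Rightarrow> complex" where
  "general_apostol_bernoulli_sin U n v x y z l =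
     egf_coeff (apostol_power l v * fps_exp x * egf (\<lambda>k. U k y) * fps_sin z) n"

end

theory Submission
  imports Defs
begin

text \<open>Both sums are binomial convolutions, so by \<open>egf_coeff_mult\<close> each is the
  \<open>n\<close>-th coefficient of a product of two exponential generating functions. By the
  double-angle formula \<open>fps_sin_double\<close> these products agree up to the factor 2: one
  factor of sin(2zt) = 2 sin(zt) cos(zt) goes to each generating function.\<close>

lemma egf_coeff_mult:
  "egf_coeff (F * G) n =
     (\<Sum>r=0..n. of_nat (n choose r) * egf_coeff F (n - r) * egf_coeff G r)"
proof -
  have "egf_coeff (F * G) n = fact n * (\<Sum>r=0..n. fps_nth G r * fps_nth F (n - r))"
    \<comment> \<open>The Cauchy product indexes its first factor by \<open>r\<close>; swapping the
      factors gives \<open>r\<close> to \<open>G\<close>.\<close>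
    by (simp add: egf_coeff_def mult.commute[of F G] fps_mult_nth)
  also have "\<dots> = (\<Sum>r=0..n. of_nat (n choose r) * egf_coeff F (n - r) * egf_coeff G r)"
    unfolding sum_distrib_left
    by (rule sum.cong) (simp_all add: egf_coeff_def binomial_fact)
  finally show ?thesis .
qed

lemma fps_sin_double: "fps_sin (2 * z) = 2 * fps_sin z * fps_cos (z :: 'a :: field_char_0)"
  using fps_sin_add[of z z] by (simp add: mult_2 algebra_simps)

theorem theorem3p8:
  fixes U :: "nat \<Rightarrow> complex \<Rightarrow> complex" and l v \<beta> x y z :: complex and n :: nat
  assumes "l \<noteq> 0" and "admissible U"
    and "apostol_order l v" and "apostol_order l \<beta>"
  shows "(\<Sum>r=0..n. of_nat (n choose r) * apostol_bernoulli (n - r) v x l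
                      * general_apostol_bernoulli_sin U r \<beta> x y (2 * z) l)
       = 2 * (\<Sum>r=0..n. of_nat (n choose r) * apostol_bernoulli_sin (n - r) v x z l
                      * general_apostol_bernoulli_cos U r \<beta> x y z l)"
proof -
  let ?A = "apostol_power l v * fps_exp x"
  let ?B = "apostol_power l \<beta> * fps_exp x * egf (\<lambda>k. U k y)"
  \<comment> \<open>The brackets mark the two factors to be convolved: the sine joins
    \<open>?A\<close>, the cosine joins \<open>?B\<close>. Writing 2 as \<open>fps_const 2\<close>
    lets it pass through coefficient extraction.\<close>
  have "?A * (?B * fps_sin (2 * z)) = fps_const 2 * (?A * fps_sin z * (?B * fps_cos z))"
    unfolding fps_sin_double fps_numeral_fps_const by (simp only: mult_ac)
  then have "egf_coeff (?A * (?B * fps_sin (2 * z))) n =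
      2 * egf_coeff (?A * fps_sin z * (?B * fps_cos z)) n"
    by (simp only: egf_coeff_def fps_mult_left_const_nth mult.left_commute)
  then show ?thesis
    by (simp only: egf_coeff_mult[of ?A "?B * fps_sin (2 * z)"]
        egf_coeff_mult[of "?A * fps_sin z" "?B * fps_cos z"]
        apostol_bernoulli_def apostol_bernoulli_sin_def
        general_apostol_bernoulli_sin_def general_apostol_bernoulli_cos_def)
qed

end
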